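(* Let $f_0\in AC_{loc}(\mathbb{R}_+)$ be such that the function $(x_1,x_2)\mapsto f_0(\max\{|x_1|,|x_2|\})$ belongs to $L_1(\mathbb{R}^2)\cap A^*(\mathbb{R}^2)$, and suppose that for some $\delta>0$ $$\int_0^\infty e^{\delta t}|f_0'(t)|\,dt<\infty.$$ Then $f_0(t)\equiv0$.
   Context: $\mathbb{R}_+=[0,+\infty)$; $AC_{loc}(\mathbb{R}_+)$ denotes functions absolutely continuous on every compact subinterval of $\mathbb{R}_+$. $A^*(\mathbb{R}^2)$ is the set of all functions $f$ of the form $f(x)=\int_{\mathbb{R}^2} g(y)e^{-i(x,y)}\,dy$ ($x\in\mathbb{R}^2$), $(x,y)=x_1y_1+x_2y_2$, with $$\|f\|_{A^*}=\int_0^\infty t\;\operatorname*{ess\,sup}_{|y|\ge t}|g(y)|\,dt<\infty,$$ where $|y|=\sqrt{y_1^2+y_2^2}$. *)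

theory Defs
  imports "HOL-Analysis.Analysis" "HOL-Probability.Essential_Supremum"
begin

text \<open>
  Absolute continuity in the \<open>\<epsilon>\<close>-\<open>\<delta>\<close> sense. A division is a finite set of nonempty compact intervals
  with pairwise disjoint interiors; the set \<open>T\<close> it covers is an arbitrary subset of \<open>S\<close>, not all
  of \<open>S\<close>. The intervals may be degenerate, and then contribute \<open>0\<close> to both sums.
\<close>

definition abs_cont_on :: "real set \<Rightarrow> (real \<Rightarrow> 'a::real_normed_vector) \<Rightarrow> bool" where
  "abs_cont_on S f \<longleftrightarrow>
     (\<forall>\<epsilon>>0. \<exists>\<delta>>0. \<forall>\<D> T. \<D> division_of T \<and> T \<subseteq> S \<and> (\<Sum>K\<in>\<D>. Sup K - Inf K) < \<delta>
        \<longrightarrow> (\<Sum>K\<in>\<D>. norm (f (Sup K) - f (Inf K))) < \<epsilon>)"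

definition AC_loc :: "(real \<Rightarrow> complex) set" where
  "AC_loc = {f. \<forall>a b. 0 \<le> a \<and> a \<le> b \<longrightarrow> abs_cont_on {a..b} f}"

text \<open>
  \<open>A_star_norm g\<close> is the norm of the function represented by \<open>g\<close>. It takes the value \<open>\<infinity>\<close> when the
  integral diverges; finiteness implies that \<open>g\<close> is integrable over the plane.
\<close>

definition A_star_norm :: "(real^2 \<Rightarrow> complex) \<Rightarrow> ennreal" where
  "A_star_norm g =
     (\<integral>\<^sup>+t\<in>{0..}. ennreal t *
        esssup (restrict_space lebesgue {y::real^2. t \<le> norm y}) (\<lambda>y. ennreal (norm (g y))) \<partial>lebesgue)"

definition A_star :: "(real^2 \<Rightarrow> complex) set" where
  "A_star = {f. \<exists>g. g \<in> borel_measurable lebesgue \<and> A_star_norm g < \<infinity> \<and>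
     (\<forall>x. f x = (LINT y|lebesgue. g y * exp (- \<i> * complex_of_real (x \<bullet> y))))}"

end

theory Submission
  imports Defs "HOL-Probability.Characteristic_Functions"
begin

text \<open>
  Write \<open>f(x) = f\<^sub>0(max{|x\<^sub>1|, |x\<^sub>2|})\<close> and let \<open>\<F>\<close> be the Fourier transform. The plane splits into the two
  double cones \<open>|x\<^sub>2| \<le> |x\<^sub>1|\<close> and \<open>|x\<^sub>1| < |x\<^sub>2|\<close>, and on each of them \<open>f\<close> depends on one coordinate only.
  Integrating over the other coordinate first turns \<open>\<F> f\<close> into a one-dimensional sine transform
  (\<open>fourier_of_max\<close>):
  \<open>y\<^sub>1 y\<^sub>2 (\<F> f)(y) = S(y\<^sub>1 + y\<^sub>2) - S(y\<^sub>1 - y\<^sub>2)\<close> with \<open>S(u) = u \<integral>\<^sub>\<real> f\<^sub>0(|s|) sin(|s| u) ds\<close>.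

  Membership in \<open>A\<^sup>*\<close> says that \<open>f = \<F> g\<close> where \<open>G(t)\<close>, the essential supremum of \<open>|g|\<close> over \<open>|y| \<ge> t\<close>,
  satisfies \<open>\<integral> t G(t) dt < \<infinity>\<close>. Since \<open>G\<close> is decreasing, \<open>t\<^sup>2 G(t) \<rightarrow> 0\<close> (\<open>decay_of_weighted_integral\<close>).
  By Fourier inversion \<open>\<F> f\<close> is a multiple of the reflected \<open>g\<close>, so \<open>|y|\<^sup>2 (\<F> f)(y) \<rightarrow> 0\<close> as \<open>|y| \<rightarrow> \<infinity>\<close>.
  Now fix \<open>a = y\<^sub>1 - y\<^sub>2\<close> and let \<open>b = y\<^sub>1 + y\<^sub>2\<close> tend to infinity. Then \<open>y\<^sub>1 y\<^sub>2 = (b\<^sup>2 - a\<^sup>2) / 4\<close> is of the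
  order of \<open>|y|\<^sup>2\<close>, hence \<open>S(b) - S(a) \<rightarrow> 0\<close>. As this holds for every \<open>a\<close>, \<open>S\<close> is constant, and
  \<open>S(0) = 0\<close>. So \<open>\<F> f\<close> vanishes off the coordinate axes, and a second application of inversion
  gives \<open>f = 0\<close>.

  Both applications of inversion come from one estimate, \<open>fourier_local_inversion\<close>: if \<open>k\<close> and \<open>\<F> k\<close> are
  integrable and \<open>|k - c| \<le> M\<close> almost everywhere near \<open>w\<close>, then \<open>(2\<pi>)\<^sup>-\<^sup>d (\<F> \<F> k)(-w)\<close> differs from \<open>c\<close> by at
  most \<open>M\<close>. With \<open>c = 0\<close> it carries an essential bound of \<open>g\<close> over to pointwise values of \<open>\<F> f\<close>; with
  \<open>c = k w\<close> it is the inversion theorem at points of continuity (\<open>fourier_inversion\<close>).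
\<close>

section \<open>Fourier transforms of integrable functions and Gaussians\<close>

text \<open>
  The sign and the missing normalisation are those of the integral that represents the functions in
  \<open>A\<^sup>*\<close>; inversion therefore carries the factor \<open>(2\<pi>)\<^sup>d\<close>.
\<close>

definition fourier :: "('a::euclidean_space \<Rightarrow> complex) \<Rightarrow> 'a \<Rightarrow> complex" where
  "fourier k x = (LINT y|lborel. k y * exp (- \<i> * of_real (x \<bullet> y)))"

lemma norm_fourier_le:
  "norm (fourier k x) \<le> (LINT y|lborel. norm (k y))"
  unfolding fourier_def
  by (rule order_trans[OF integral_norm_bound]) (simp add: norm_mult)

lemma continuous_fourier:
  fixes k :: "'a::euclidean_space \<Rightarrow> complex"
  assumes k: "integrable lborel k"
  shows "isCont (fourier k) x"
  unfolding continuous_at_sequentially comp_def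
proof (intro allI impI)
  fix X :: "nat \<Rightarrow> 'a" assume X: "X \<longlonglongrightarrow> x"
  have [measurable]: "k \<in> borel_measurable borel"
    using k by auto
  show "(\<lambda>n. fourier k (X n)) \<longlonglongrightarrow> fourier k x"
    unfolding fourier_def
    by (rule integral_dominated_convergence[where w="\<lambda>y. norm (k y)"])
       (use k X in \<open>auto simp: norm_mult intro!: tendsto_intros\<close>)
qed

text \<open>
  A rescaling of the characteristic function of the standard normal distribution.
\<close>

lemma gaussian_integral_real:
  fixes s u :: real
  assumes s: "s > 0"
  shows "has_bochner_integral lborel
           (\<lambda>x. of_real (exp (- (s * x)\<^sup>2 / 2)) * exp (\<i> * of_real (x * u)))
           (of_real (sqrt (2 * pi) / s * exp (- (u / s)\<^sup>2 / 2)))"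
proof -
  let ?e = "\<lambda>v x. of_real (exp (- x\<^sup>2 / 2)) * exp (\<i> * of_real (x * v)) :: complex"
  have int: "integrable lborel (?e v)" for v
  proof -
    have "integrable lborel (\<lambda>x. sqrt (2 * pi) * std_normal_density x)"
      using integrable_std_normal_moment[of 0] by simp
    then have "integrable lborel (\<lambda>x::real. exp (- x\<^sup>2 / 2))"
      by (simp add: std_normal_density_def)
    then show ?thesis
      by (rule Bochner_Integration.integrable_bound) (auto simp: norm_mult)
  qed
  have val: "(LINT x|lborel. ?e v x) = of_real (sqrt (2 * pi) * exp (- v\<^sup>2 / 2))" for v
  proof -
    have "of_real (exp (- v\<^sup>2 / 2)) = (LINT x|lborel. std_normal_density x *\<^sub>R iexp (v * x))"
      using char_std_normal_distribution
      by (auto simp: char_def integral_density fun_eq_iff)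
    also have "\<dots> = (LINT x|lborel. of_real (1 / sqrt (2 * pi)) * ?e v x)"
      by (intro Bochner_Integration.integral_cong)
         (auto simp: std_normal_density_def scaleR_conv_of_real mult_ac)
    also have "\<dots> = of_real (1 / sqrt (2 * pi)) * (LINT x|lborel. ?e v x)"
      by (rule integral_mult_right_zero)
    finally show ?thesis by (simp add: field_simps)
  qed
  have "has_bochner_integral lborel (\<lambda>x. ?e (u / s) (0 + s * x))
          (of_real (sqrt (2 * pi) * exp (- (u / s)\<^sup>2 / 2)) /\<^sub>R \<bar>s\<bar>)"
    using s int[of "u / s"] val[of "u / s"]
    by (subst lborel_has_bochner_integral_real_affine_iff[symmetric])
       (auto simp: has_bochner_integral_iff)
  then show ?thesis
    using s by (simp add: scaleR_conv_of_real field_simps)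
qed

text \<open>
  The Gaussian is the product of its coordinate factors, and so is the exponential, so that the
  integral is a product of one-dimensional ones.
\<close>

lemma gaussian_integral:
  fixes u :: "'a::euclidean_space"
  assumes s: "s > 0"
  shows "has_bochner_integral lborel
           (\<lambda>x. of_real (exp (- (s * norm x)\<^sup>2 / 2)) * exp (\<i> * of_real (x \<bullet> u)))
           (of_real ((sqrt (2 * pi) / s) ^ DIM('a) * exp (- (norm u / s)\<^sup>2 / 2)))"
proof -
  define h where "h b x = (of_real (exp (- (s * x)\<^sup>2 / 2)) * exp (\<i> * of_real (x * (u \<bullet> b))) :: complex)" for b :: 'a and x
  have norm2: "(norm x)\<^sup>2 = (\<Sum>b\<in>Basis. (x \<bullet> b)\<^sup>2)" for x :: 'a
    by (subst power2_norm_eq_inner, subst euclidean_inner) (simp add: power2_eq_square)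
  have h: "has_bochner_integral lborel (h b) (of_real (sqrt (2 * pi) / s * exp (- (u \<bullet> b / s)\<^sup>2 / 2)))" for b
    unfolding h_def using gaussian_integral_real[OF s] by blast
  have h_meas[measurable]: "h b \<in> borel_measurable borel" for b
    unfolding h_def by measurable
  have eq: "of_real (exp (- (s * norm x)\<^sup>2 / 2)) * exp (\<i> * of_real (x \<bullet> u)) = (\<Prod>b\<in>Basis. h b (x \<bullet> b))" for x
    unfolding h_def prod.distrib
    by (simp add: power_mult_distrib norm2 euclidean_inner[of x u] flip: exp_sum of_real_prod)
       (simp add: exp_sum sum_distrib_left sum_negf sum_divide_distrib flip: exp_sum of_real_exp)
  interpret product_sigma_finite "\<lambda>_::'a. lborel :: real measure" ..
  have meas[measurable]: "(\<lambda>f. \<Sum>b\<in>Basis. f b *\<^sub>R b) \<in> measurable (\<Pi>\<^sub>M b\<in>(Basis::'a set). (lborel::real measure)) borel"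
    by measurable
  have comp: "(\<Prod>b\<in>Basis. h b ((\<Sum>c\<in>Basis. f c *\<^sub>R c) \<bullet> b)) = (\<Prod>b\<in>Basis. h b (f b))" for f
    by (intro prod.cong) (auto simp: inner_sum_left inner_Basis if_distrib cong: if_cong)
  have "integrable (\<Pi>\<^sub>M b\<in>(Basis::'a set). (lborel::real measure)) (\<lambda>f. \<Prod>b\<in>Basis. h b (f b))"
    using h by (intro product_integrable_prod) (auto simp: has_bochner_integral_iff)
  moreover have "integral\<^sup>L (\<Pi>\<^sub>M b\<in>(Basis::'a set). (lborel::real measure)) (\<lambda>f. \<Prod>b\<in>Basis. h b (f b)) =
     (\<Prod>b\<in>Basis. of_real (sqrt (2 * pi) / s * exp (- (u \<bullet> b / s)\<^sup>2 / 2)))"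
    using h by (subst product_integral_prod) (auto simp: has_bochner_integral_iff)
  moreover have "(\<Prod>b\<in>Basis. of_real (sqrt (2 * pi) / s * exp (- (u \<bullet> b / s)\<^sup>2 / 2))) =
      (of_real ((sqrt (2 * pi) / s) ^ DIM('a) * exp (- (norm u / s)\<^sup>2 / 2)) :: complex)"
  proof -
    have "(\<Prod>b\<in>(Basis::'a set). sqrt (2 * pi) / s * exp (- (u \<bullet> b / s)\<^sup>2 / 2)) =
        (sqrt (2 * pi) / s) ^ DIM('a) * exp (\<Sum>b\<in>Basis. - (u \<bullet> b / s)\<^sup>2 / 2)"
      by (simp only: prod.distrib prod_constant exp_sum[OF finite_Basis])
    also have "(\<Sum>b\<in>Basis. - (u \<bullet> b / s)\<^sup>2 / 2) = - (norm u / s)\<^sup>2 / 2"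
      by (simp add: power_divide norm2 sum_divide_distrib sum_negf)
    finally show ?thesis by (simp only: of_real_prod[symmetric])
  qed
  ultimately show ?thesis
    unfolding eq has_bochner_integral_iff
    by (subst (1 2) lborel_eq) (simp add: integrable_distr_eq integral_distr comp)
qed

section \<open>Local Fourier inversion\<close>

text \<open>
  Fubini's theorem moves the transform from \<open>k\<close> to the Gaussian. On the left the Gaussian factor
  tends to \<open>1\<close> as \<open>s \<rightarrow> 0\<close>; on the right stands the average of \<open>k\<close> against a kernel of mass \<open>(2\<pi>)\<^sup>d\<close> that
  concentrates at \<open>w\<close>.
\<close>

lemma fourier_gaussian_duality:
  fixes k :: "'a::euclidean_space \<Rightarrow> complex"
  assumes k: "integrable lborel k" and s: "s > 0"
  shows "(LINT x|lborel. fourier k x * (of_real (exp (- (s * norm x)\<^sup>2 / 2)) * exp (\<i> * of_real (x \<bullet> w)))) =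
    (LINT y|lborel. k y * of_real ((sqrt (2 * pi) / s) ^ DIM('a) * exp (- (norm (w - y) / s)\<^sup>2 / 2)))"
proof -
  define G where "G x = exp (- (s * norm x)\<^sup>2 / 2)" for x :: 'a
  define \<Phi> where "\<Phi> x y = k y * (of_real (G x) * exp (\<i> * of_real (x \<bullet> (w - y))))" for x y
  note gauss = gaussian_integral[OF s, where 'a='a, folded G_def, unfolded has_bochner_integral_iff]
  have [measurable]: "k \<in> borel_measurable borel" "G \<in> borel_measurable borel"
    using k by (auto simp: G_def[abs_def])
  have G0: "G x \<ge> 0" for x by (simp add: G_def)
  have intG: "integrable lborel G"
  proof -
    have "integrable lborel (\<lambda>x. complex_of_real (G x))"
      using gauss[of "0 :: 'a"] by simp
    then show ?thesis by (simp only: complex_of_real_integrable_eq)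
  qed
  have norm\<Phi>: "norm (\<Phi> x y) = norm (k y) * G x" for x y
    using G0 by (simp add: \<Phi>_def norm_mult)
  have \<Phi>_meas: "(\<lambda>(x, y). \<Phi> x y) \<in> borel_measurable (lborel \<Otimes>\<^sub>M lborel)"
    unfolding \<Phi>_def by measurable
  have int: "integrable (lborel \<Otimes>\<^sub>M lborel) (\<lambda>(x, y). \<Phi> x y)"
  proof (rule lborel_pair.Fubini_integrable[OF \<Phi>_meas])
    show "integrable lborel (\<lambda>x. LINT y|lborel. norm (case (x, y) of (x, y) \<Rightarrow> \<Phi> x y))"
      using intG by (simp add: norm\<Phi>)
    show "AE x in lborel. integrable lborel (\<lambda>y. case (x, y) of (x, y) \<Rightarrow> \<Phi> x y)"
    proof (rule AE_I2)
      fix x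
      have "(\<lambda>y. \<Phi> x y) \<in> borel_measurable lborel"
        unfolding \<Phi>_def by measurable
      moreover have "integrable lborel (\<lambda>y. norm (\<Phi> x y))"
        using k by (simp add: norm\<Phi>)
      ultimately show "integrable lborel (\<lambda>y. case (x, y) of (x, y) \<Rightarrow> \<Phi> x y)"
        by (simp add: integrable_norm_iff)
    qed
  qed
  have "fourier k x * (of_real (G x) * exp (\<i> * of_real (x \<bullet> w))) = (LINT y|lborel. \<Phi> x y)" for x
  proof -
    have "exp (- \<i> * of_real (x \<bullet> y)) * exp (\<i> * of_real (x \<bullet> w)) = exp (\<i> * of_real (x \<bullet> (w - y)))" for y
      by (simp add: inner_diff_right right_diff_distrib flip: exp_add)
    then have "k y * exp (- \<i> * of_real (x \<bullet> y)) * (of_real (G x) * exp (\<i> * of_real (x \<bullet> w))) = \<Phi> x y" for y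
      unfolding \<Phi>_def by (simp only: mult.left_commute mult.assoc)
    then show ?thesis
      unfolding fourier_def integral_mult_left_zero[symmetric] by simp
  qed
  then have "(LINT x|lborel. fourier k x * (of_real (G x) * exp (\<i> * of_real (x \<bullet> w))))
     = (LINT x|lborel. LINT y|lborel. \<Phi> x y)" by simp
  also have "\<dots> = (LINT y|lborel. LINT x|lborel. \<Phi> x y)"
    using lborel_pair.Fubini_integral[OF int] by simp
  also have "\<dots> = (LINT y|lborel. k y * of_real ((sqrt (2 * pi) / s) ^ DIM('a) * exp (- (norm (w - y) / s)\<^sup>2 / 2)))"
    unfolding \<Phi>_def using gauss by (simp only: integral_mult_right_zero)
  finally show ?thesis unfolding G_def .
qed

lemma power_times_gaussian_tendsto_0:
  fixes c r :: real
  assumes r: "r > 0"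
  shows "(\<lambda>n. (c * real (Suc n)) ^ d * exp (- (r * real (Suc n))\<^sup>2 / 4)) \<longlonglongrightarrow> 0"
proof (rule tendsto_rabs_zero_cancel, rule tendsto_sandwich[OF _ _ tendsto_const])
  define q where "q = r\<^sup>2 / 4"
  have q: "q > 0" using r by (simp add: q_def)
  define X where "X n = q * real (Suc n)" for n
  have "filterlim X at_top sequentially"
    unfolding X_def using q by real_asymp
  then have "(\<lambda>n. X n ^ d / exp (X n)) \<longlonglongrightarrow> 0"
    by (rule filterlim_compose[OF tendsto_power_div_exp_0])
  then show "(\<lambda>n. \<bar>c / q\<bar> ^ d * (X n ^ d / exp (X n))) \<longlonglongrightarrow> 0"
    by (rule tendsto_mult_right_zero)
  have "\<bar>(c * real (Suc n)) ^ d * exp (- (r * real (Suc n))\<^sup>2 / 4)\<bar> \<le> \<bar>c / q\<bar> ^ d * (X n ^ d / exp (X n))" for n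
  proof -
    have "X n \<le> q * (real (Suc n))\<^sup>2"
      unfolding X_def using q by (intro mult_left_mono) (auto simp: power2_eq_square)
    then have "exp (- (r * real (Suc n))\<^sup>2 / 4) \<le> exp (- X n)"
      by (simp add: q_def power_mult_distrib)
    moreover have "\<bar>c * real (Suc n)\<bar> ^ d = \<bar>c / q\<bar> ^ d * X n ^ d"
      unfolding X_def power_mult_distrib[symmetric] using q by (simp add: abs_mult)
    moreover have "X n \<ge> 0" using q by (simp add: X_def)
    moreover have "X n ^ d / exp (X n) = X n ^ d * exp (- X n)"
      by (simp add: exp_minus field_simps)
    ultimately have "\<bar>c * real (Suc n)\<bar> ^ d * exp (- (r * real (Suc n))\<^sup>2 / 4) \<le> \<bar>c / q\<bar> ^ d * (X n ^ d / exp (X n))"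
      by (simp only: mult.assoc) (intro mult_left_mono, auto)
    then show ?thesis
      by (simp only: abs_mult power_abs abs_exp_cancel)
  qed
  then show "\<forall>\<^sub>F n in sequentially. \<bar>(c * real (Suc n)) ^ d * exp (- (r * real (Suc n))\<^sup>2 / 4)\<bar> \<le> \<bar>c / q\<bar> ^ d * (X n ^ d / exp (X n))"
    by simp
qed auto

text \<open>
  The hypothesis on \<open>k\<close> is local and holds only almost everywhere, while the conclusion is pointwise:
  the value of the double transform is the limit of Gaussian averages of \<open>k\<close> around \<open>w\<close>, to which the part
  of \<open>k\<close> outside the ball contributes nothing in the limit.
\<close>

lemma fourier_local_inversion:
  fixes k :: "'a::euclidean_space \<Rightarrow> complex" and c :: complex and r M :: real
  assumes k: "integrable lborel k" and fk: "integrable lborel (fourier k)"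
    and r: "r > 0" and M: "M \<ge> 0"
    and near: "AE y in lborel. dist y w < r \<longrightarrow> norm (k y - c) \<le> M"
  shows "norm (fourier (fourier k) (- w) - (2 * pi) ^ DIM('a) * c) \<le> (2 * pi) ^ DIM('a) * M"
proof -
  define s where "s n = 1 / real (Suc n)" for n
  define A where "A n = (sqrt (2 * pi) / s n) ^ DIM('a)" for n
  define E where "E n y = exp (- (norm (w - y) / s n)\<^sup>2 / 2)" for n y
  define I where "I n = (LINT y|lborel. k y * of_real (A n * E n y))" for n
  define T where "T y = norm (k y) + norm c * exp (- (norm (w - y))\<^sup>2 / 4)" for y
  have s: "0 < s n" "s n \<le> 1" for n by (auto simp: s_def)
  have [measurable]: "k \<in> borel_measurable borel" "fourier k \<in> borel_measurable borel"
    using k fk by auto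
  have A0: "A n \<ge> 0" for n using s[of n] by (auto simp: A_def)
  have bump: "has_bochner_integral lborel (\<lambda>y. exp (- (norm (w - y) / t)\<^sup>2 / 2)) ((sqrt (2 * pi) * t) ^ DIM('a))"
    if t: "t > 0" for t
  proof -
    let ?h = "\<lambda>x::'a. exp (- (1 / t * norm x)\<^sup>2 / 2)"
    have "has_bochner_integral lborel (\<lambda>x. complex_of_real (?h x)) (of_real ((sqrt (2 * pi) * t) ^ DIM('a)))"
      using gaussian_integral[of "1 / t" "0 :: 'a"] t by simp
    then have h: "has_bochner_integral lborel ?h ((sqrt (2 * pi) * t) ^ DIM('a))"
      by (simp only: has_bochner_integral_iff complex_of_real_integrable_eq integral_complex_of_real of_real_eq_iff)
    have "has_bochner_integral (distr lborel borel (\<lambda>y. w + (-1) *\<^sub>R y)) ?h ((sqrt (2 * pi) * t) ^ DIM('a))"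
      using h by (subst (asm) lborel_affine[of "-1" w]) (auto simp: density_1)
    then show ?thesis
      by (simp add: has_bochner_integral_iff integrable_distr_eq integral_distr)
  qed
  have intE: "integrable lborel (E n)" for n
    using bump[OF s(1)[of n]] unfolding has_bochner_integral_iff E_def by blast
  have valE: "A n * (LINT y|lborel. E n y) = (2 * pi) ^ DIM('a)" for n
  proof -
    have "(LINT y|lborel. E n y) = (sqrt (2 * pi) * s n) ^ DIM('a)"
      using bump[OF s(1)[of n]] unfolding has_bochner_integral_iff E_def by blast
    then have "A n * (LINT y|lborel. E n y) = (sqrt (2 * pi) / s n * (sqrt (2 * pi) * s n)) ^ DIM('a)"
      by (simp only: A_def power_mult_distrib)
    also have "sqrt (2 * pi) / s n * (sqrt (2 * pi) * s n) = 2 * pi"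
      using s(1)[of n] by simp
    finally show ?thesis .
  qed
  have intT: "integrable lborel T"
  proof -
    have "integrable lborel (\<lambda>y. exp (- (norm (w - y))\<^sup>2 / 4))"
      using bump[of "sqrt 2"] by (simp add: has_bochner_integral_iff power_divide)
    then show ?thesis unfolding T_def using k by auto
  qed
  have I_lim: "I \<longlonglongrightarrow> fourier (fourier k) (- w)"
  proof -
    have s0: "s \<longlonglongrightarrow> 0" unfolding s_def by real_asymp
    have "I = (\<lambda>n. LINT x|lborel. fourier k x * (of_real (exp (- (s n * norm x)\<^sup>2 / 2)) * exp (\<i> * of_real (x \<bullet> w))))"
      unfolding I_def A_def E_def using fourier_gaussian_duality[OF k s(1)] by (simp add: fun_eq_iff)
    also have "\<dots> \<longlonglongrightarrow> (LINT x|lborel. fourier k x * exp (\<i> * of_real (x \<bullet> w)))"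
    proof (rule integral_dominated_convergence[where w="\<lambda>x. norm (fourier k x)"])
      have "(\<lambda>n. fourier k x * (of_real (exp (- (s n * norm x)\<^sup>2 / 2)) * exp (\<i> * of_real (x \<bullet> w))))
         \<longlonglongrightarrow> fourier k x * (of_real (exp (- (0 * norm x)\<^sup>2 / 2)) * exp (\<i> * of_real (x \<bullet> w)))" for x
        by (intro tendsto_intros s0) simp_all
      then show "AE x in lborel. (\<lambda>n. fourier k x * (of_real (exp (- (s n * norm x)\<^sup>2 / 2)) * exp (\<i> * of_real (x \<bullet> w))))
         \<longlonglongrightarrow> fourier k x * exp (\<i> * of_real (x \<bullet> w))"
        by simp
      show "AE x in lborel. norm (fourier k x * (of_real (exp (- (s n * norm x)\<^sup>2 / 2)) * exp (\<i> * of_real (x \<bullet> w)))) \<le> norm (fourier k x)" for n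
        by (simp add: norm_mult mult_left_le)
    qed (use fk in auto)
    also have "(LINT x|lborel. fourier k x * exp (\<i> * of_real (x \<bullet> w))) = fourier (fourier k) (- w)"
      unfolding fourier_def[of "fourier k"] by (simp add: inner_commute[of w])
    finally show ?thesis .
  qed
  \<comment> \<open>Inside the ball the kernel has mass at most \<open>(2\<pi>)\<^sup>d\<close>. Outside, half of its exponent yields the
      vanishing factor \<open>exp (- (r / s n)\<^sup>2 / 4)\<close>; the other half makes the constant \<open>c\<close> integrable
      uniformly in \<open>n\<close>, because \<open>s n \<le> 1\<close>.\<close>
  have bound: "norm (I n - (2 * pi) ^ DIM('a) * c) \<le> (2 * pi) ^ DIM('a) * M + A n * exp (- (r / s n)\<^sup>2 / 4) * (LINT y|lborel. T y)" for n
  proof -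
    have kE: "integrable lborel (\<lambda>y. k y * of_real (A n * E n y))"
    proof (rule Bochner_Integration.integrable_bound[OF integrable_mult_right[OF k, of "of_real (A n)"]])
      have "norm (k y) * (A n * E n y) \<le> norm (k y) * A n" for y
        using A0[of n] by (intro mult_left_mono mult_left_le) (auto simp: E_def)
      then show "AE y in lborel. norm (k y * of_real (A n * E n y)) \<le> norm (of_real (A n) * k y)"
        using A0[of n] by (auto simp: norm_mult E_def mult_ac)
    qed (simp add: E_def)
    have cE: "integrable lborel (\<lambda>y. c * of_real (A n * E n y))"
      using intE[of n] by (intro integrable_mult_right integrable_of_real) auto
    have "(LINT y|lborel. c * of_real (A n * E n y)) = c * of_real (A n * (LINT y|lborel. E n y))"
      by (simp only: integral_mult_right_zero integral_complex_of_real)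
    then have "(2 * pi) ^ DIM('a) * c = (LINT y|lborel. c * of_real (A n * E n y))"
      unfolding valE by (simp add: mult.commute) metis
    then have "I n - (2 * pi) ^ DIM('a) * c = (LINT y|lborel. (k y - c) * of_real (A n * E n y))"
      unfolding I_def using kE cE by (simp add: left_diff_distrib)
    also have "norm \<dots> \<le> (LINT y|lborel. M * (A n * E n y) + A n * exp (- (r / s n)\<^sup>2 / 4) * T y)"
    proof (rule order_trans[OF integral_norm_bound integral_mono_AE])
      show "integrable lborel (\<lambda>y. norm ((k y - c) * of_real (A n * E n y)))"
        using kE cE by (intro integrable_norm) (simp add: left_diff_distrib)
      show "integrable lborel (\<lambda>y. M * (A n * E n y) + A n * exp (- (r / s n)\<^sup>2 / 4) * T y)"
        using intE[of n] intT by auto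
      show "AE y in lborel. norm ((k y - c) * of_real (A n * E n y)) \<le> M * (A n * E n y) + A n * exp (- (r / s n)\<^sup>2 / 4) * T y"
        using near
      proof eventually_elim
        case (elim y)
        have E0: "E n y \<ge> 0" by (simp add: E_def)
        have T0: "T y \<ge> 0" by (simp add: T_def)
        show ?case
        proof (cases "dist y w < r")
          case True
          then have "norm (k y - c) * (A n * E n y) \<le> M * (A n * E n y)"
            using elim A0 E0 by (intro mult_right_mono) auto
          moreover have "0 \<le> A n * exp (- (r / s n)\<^sup>2 / 4) * T y"
            using A0 T0 by simp
          ultimately show ?thesis
            using A0 E0 by (simp add: norm_mult)
        next
          case False
          then have d: "r \<le> norm (w - y)" by (simp add: dist_norm norm_minus_commute)
          have split: "E n y = exp (- (norm (w - y) / s n)\<^sup>2 / 4) * exp (- (norm (w - y) / s n)\<^sup>2 / 4)"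
            unfolding E_def exp_add[symmetric] by simp
          have e1: "exp (- (norm (w - y) / s n)\<^sup>2 / 4) \<le> exp (- (r / s n)\<^sup>2 / 4)"
            using d r s[of n] by (auto intro!: power_mono divide_right_mono)
          have "norm (w - y) \<le> norm (w - y) / s n"
            using s[of n] by (simp add: field_simps mult_left_le_one_le)
          then have e2: "exp (- (norm (w - y) / s n)\<^sup>2 / 4) \<le> exp (- (norm (w - y))\<^sup>2 / 4)"
            by (auto intro!: power_mono)
          have "norm (k y - c) * exp (- (norm (w - y) / s n)\<^sup>2 / 4) \<le> norm (k y) * 1 + norm c * exp (- (norm (w - y))\<^sup>2 / 4)"
          proof -
            have "norm (k y - c) * exp (- (norm (w - y) / s n)\<^sup>2 / 4)
               \<le> (norm (k y) + norm c) * exp (- (norm (w - y) / s n)\<^sup>2 / 4)"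
              by (intro mult_right_mono norm_triangle_ineq4) auto
            also have "\<dots> \<le> norm (k y) * 1 + norm c * exp (- (norm (w - y))\<^sup>2 / 4)"
              unfolding distrib_right using e2 by (intro add_mono mult_left_mono) auto
            finally show ?thesis .
          qed
          then have "norm (k y - c) * exp (- (norm (w - y) / s n)\<^sup>2 / 4) * exp (- (norm (w - y) / s n)\<^sup>2 / 4) \<le> T y * exp (- (r / s n)\<^sup>2 / 4)"
            using e1 T0 by (intro mult_mono) (auto simp: T_def)
          then have "A n * (norm (k y - c) * E n y) \<le> A n * (T y * exp (- (r / s n)\<^sup>2 / 4))"
            unfolding split using A0[of n] by (intro mult_left_mono) (auto simp: mult_ac)
          moreover have "0 \<le> M * (A n * E n y)" using M A0[of n] E0 by simp
          ultimately show ?thesis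
            using A0[of n] E0 by (simp add: norm_mult mult_ac)
        qed
      qed
    qed
    also have "\<dots> = (2 * pi) ^ DIM('a) * M + A n * exp (- (r / s n)\<^sup>2 / 4) * (LINT y|lborel. T y)"
      using intE[of n] intT valE[of n] by (simp add: mult.commute)
    finally show ?thesis .
  qed
  have "(\<lambda>n. A n * exp (- (r / s n)\<^sup>2 / 4)) \<longlonglongrightarrow> 0"
    using power_times_gaussian_tendsto_0[OF r, of "sqrt (2 * pi)" "DIM('a)"] by (simp add: A_def s_def)
  then have "(\<lambda>n. (2 * pi) ^ DIM('a) * M + A n * exp (- (r / s n)\<^sup>2 / 4) * (LINT y|lborel. T y)) \<longlonglongrightarrow> (2 * pi) ^ DIM('a) * M + 0 * (LINT y|lborel. T y)"
    by (intro tendsto_intros)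
  then show ?thesis
    using bound by (intro LIMSEQ_le[OF tendsto_norm[OF tendsto_diff[OF I_lim tendsto_const]]]) auto
qed

corollary fourier_inversion:
  fixes k :: "'a::euclidean_space \<Rightarrow> complex"
  assumes k: "integrable lborel k" and fk: "integrable lborel (fourier k)" and cont: "isCont k w"
  shows "fourier (fourier k) (- w) = (2 * pi) ^ DIM('a) * k w"
proof -
  have "norm (fourier (fourier k) (- w) - (2 * pi) ^ DIM('a) * k w) \<le> (2 * pi) ^ DIM('a) * e" if e: "e > 0" for e
  proof -
    obtain r where "r > 0" "\<And>y. dist y w < r \<Longrightarrow> dist (k y) (k w) < e"
      using cont e unfolding continuous_at_eps_delta by blast
    then show ?thesis
      using e by (intro fourier_local_inversion[OF k fk]) (auto simp: dist_norm less_imp_le)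
  qed
  then have "norm (fourier (fourier k) (- w) - (2 * pi) ^ DIM('a) * k w) / (2 * pi) ^ DIM('a) \<le> 0 + e" if "e > 0" for e
    using that by (simp add: field_simps)
  then have "norm (fourier (fourier k) (- w) - (2 * pi) ^ DIM('a) * k w) / (2 * pi) ^ DIM('a) \<le> 0"
    by (rule field_le_epsilon)
  moreover have "(2 * pi) ^ DIM('a) > 0" by simp
  ultimately show ?thesis
    by (simp add: divide_le_0_iff not_le[symmetric] del: zero_less_power)
qed

section \<open>Functions of the maximum norm on the plane\<close>

lemma distr_lborel_vec2:
  "distr lborel borel (\<lambda>x::real^2. (x $ 1, x $ 2)) = lborel \<Otimes>\<^sub>M lborel"
  unfolding lborel_prod
proof (rule lborel_eqI[symmetric])
  fix l u :: "real \<times> real"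
  assume le: "\<And>b. b \<in> Basis \<Longrightarrow> l \<bullet> b \<le> u \<bullet> b"
  have lu: "fst l \<le> fst u" "snd l \<le> snd u"
    using le[of "(1, 0)"] le[of "(0, 1)"] by (auto simp: inner_prod_def Basis_prod_def)
  have meas: "(\<lambda>x::real^2. (x $ 1, x $ 2)) \<in> borel_measurable borel"
    by (intro borel_measurable_continuous_onI continuous_intros)
  have "(\<lambda>x::real^2. (x $ 1, x $ 2)) -` box l u = box (vector [fst l, snd l]) (vector [fst u, snd u])"
    by (cases l; cases u) (auto simp: mem_box_cart forall_2 vector_2 mem_box Basis_prod_def)
  then have "emeasure (distr lborel borel (\<lambda>x::real^2. (x $ 1, x $ 2))) (box l u)
      = emeasure lborel (box (vector [fst l, snd l]) (vector [fst u, snd u] :: real^2))"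
    using meas by (subst emeasure_distr) auto
  also have "\<dots> = (\<Prod>b\<in>Basis. (vector [fst u, snd u] - vector [fst l, snd l] :: real^2) \<bullet> b)"
  proof (rule emeasure_lborel_box)
    fix b :: "real^2" assume "b \<in> Basis"
    then obtain i where "b = axis i 1" by (auto simp: Basis_vec_def)
    then show "vector [fst l, snd l] \<bullet> b \<le> vector [fst u, snd u] \<bullet> b"
      using lu exhaust_2[of i] by (auto simp: inner_axis vector_2)
  qed
  also have "(\<Prod>b\<in>Basis. (vector [fst u, snd u] - vector [fst l, snd l] :: real^2) \<bullet> b) = (fst u - fst l) * (snd u - snd l)"
  proof -
    have B: "(Basis :: (real^2) set) = {axis 1 1, axis 2 1}"
      by (auto simp: Basis_vec_def UNIV_2)
    have "axis 1 1 \<noteq> (axis 2 1 :: real^2)" by (simp add: axis_eq_axis)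
    then show ?thesis unfolding B by (simp add: inner_axis vector_2)
  qed
  also have "(fst u - fst l) * (snd u - snd l) = (\<Prod>b\<in>Basis. (u - l) \<bullet> b)"
    by (cases l; cases u) (simp add: Basis_prod_def)
  finally show "emeasure (distr lborel borel (\<lambda>x::real^2. (x $ 1, x $ 2))) (box l u) = (\<Prod>b\<in>Basis. (u - l) \<bullet> b)" .
qed simp

lemma measurable_vec2:
  "(\<lambda>x::real^2. (x $ 1, x $ 2)) \<in> lborel \<rightarrow>\<^sub>M borel"
proof -
  have "(\<lambda>x::real^2. (x $ 1, x $ 2)) \<in> borel_measurable borel"
    by (intro borel_measurable_continuous_onI continuous_intros)
  then show ?thesis by simp
qed

lemma integrable_max_profile:
  fixes h :: "real \<Rightarrow> complex"
  assumes F: "integrable lborel (\<lambda>x::real^2. h (max \<bar>x $ 1\<bar> \<bar>x $ 2\<bar>))"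
    and h_meas[measurable]: "(\<lambda>s. h \<bar>s\<bar>) \<in> borel_measurable borel"
  shows "integrable (lborel \<Otimes>\<^sub>M lborel) (\<lambda>(s, t). h (max \<bar>s\<bar> \<bar>t\<bar>))"
proof -
  have "(\<lambda>z. h \<bar>max \<bar>fst z\<bar> \<bar>snd z\<bar>\<bar>) \<in> borel_measurable (lborel \<Otimes>\<^sub>M lborel)"
    by (rule measurable_compose[OF _ h_meas]) measurable
  then have "(\<lambda>(s, t). h (max \<bar>s\<bar> \<bar>t\<bar>)) \<in> borel_measurable (lborel \<Otimes>\<^sub>M lborel)"
    by (simp add: case_prod_beta)
  then show ?thesis
    using F measurable_vec2 unfolding distr_lborel_vec2[symmetric]
    by (subst integrable_distr_eq) auto
qed

text \<open>
  For almost every fixed \<open>s\<close> the section \<open>t \<mapsto> h(max{|s|, |t|})\<close> is integrable by Fubini's theorem, and it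
  agrees with \<open>h(|t|)\<close> outside the bounded interval \<open>|t| \<le> |s|\<close>.
\<close>

lemma integrable_profile_line:
  fixes h :: "real \<Rightarrow> complex"
  assumes F: "integrable lborel (\<lambda>x::real^2. h (max \<bar>x $ 1\<bar> \<bar>x $ 2\<bar>))"
    and h_meas[measurable]: "(\<lambda>s. h \<bar>s\<bar>) \<in> borel_measurable borel"
    and bound: "\<And>s. norm (h \<bar>s\<bar>) \<le> B"
  shows "integrable lborel (\<lambda>s. h \<bar>s\<bar>)"
proof -
  note integrable_max_profile[OF F h_meas]
  then have "AE s in lborel. integrable lborel (\<lambda>t. h (max \<bar>s\<bar> \<bar>t\<bar>))"
    by (rule lborel_pair.AE_integrable_fst)
  then obtain s where s: "integrable lborel (\<lambda>t. h (max \<bar>s\<bar> \<bar>t\<bar>))"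
    by (auto dest!: eventually_happens simp: ae_filter_eq_bot_iff)
  have ind: "integrable lborel (\<lambda>t. B * indicator {-\<bar>s\<bar>..\<bar>s\<bar>} t :: real)"
    by (intro integrable_mult_right integrable_real_indicator) auto
  have "B \<ge> 0" using order_trans[OF norm_ge_zero bound[of 0]] .
  then have "norm (h \<bar>t\<bar>) \<le> norm (h (max \<bar>s\<bar> \<bar>t\<bar>)) + B * indicator {-\<bar>s\<bar>..\<bar>s\<bar>} t" for t
    using bound[of t]
    by (cases "\<bar>t\<bar> \<le> \<bar>s\<bar>") (auto simp: indicator_def max_def intro: add_increasing)
  then have "norm (h \<bar>t\<bar>) \<le> norm (norm (h (max \<bar>s\<bar> \<bar>t\<bar>)) + B * indicator {-\<bar>s\<bar>..\<bar>s\<bar>} t)" for t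
    unfolding real_norm_def by (rule order_trans[OF _ abs_ge_self])
  then show ?thesis
    using Bochner_Integration.integrable_add[OF integrable_norm[OF s] ind]
    by (elim Bochner_Integration.integrable_bound) auto
qed

lemma integral_exp_symmetric_interval:
  fixes q r :: real
  assumes "r \<ge> 0"
  shows "of_real q * (LINT t|lborel. indicator {-r..r} t *\<^sub>R exp (- \<i> * of_real (t * q))) = of_real (2 * sin (r * q))"
proof -
  have "(LINT t|lborel. indicator {-r..r} t *\<^sub>R (of_real q * exp (- \<i> * of_real (t * q))))
      = \<i> * exp (- \<i> * of_real (r * q)) - \<i> * exp (- \<i> * of_real (- r * q))"
  proof (rule integral_FTC_atLeastAtMost)
    fix t :: real
    have "((\<lambda>z. \<i> * exp (- \<i> * (z * of_real q))) has_field_derivative of_real q * exp (- \<i> * of_real (t * q))) (at (of_real t))"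
      by (auto intro!: derivative_eq_intros simp: field_simps)
    from has_vector_derivative_real_field[OF this]
    show "((\<lambda>t. \<i> * exp (- \<i> * of_real (t * q))) has_vector_derivative of_real q * exp (- \<i> * of_real (t * q))) (at t within {- r..r})"
      by simp
  qed (use assms in \<open>auto intro!: continuous_intros\<close>)
  also have "\<dots> = of_real (2 * sin (r * q))"
    by (simp add: complex_eq_iff Re_exp Im_exp)
  also have "(LINT t|lborel. indicator {-r..r} t *\<^sub>R (of_real q * exp (- \<i> * of_real (t * q))))
      = of_real q * (LINT t|lborel. indicator {-r..r} t *\<^sub>R exp (- \<i> * of_real (t * q)))"
    by (subst integral_mult_right_zero[symmetric]) (simp add: mult_ac)
  finally show ?thesis .
qed

text \<open>
  The predicate \<open>P\<close> leaves open what happens on the null set \<open>|t| = |s|\<close>, so that the closed and the open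
  double cone, which together partition the plane, are both covered. Integrating over \<open>t\<close> first produces
  the sine; the substitution \<open>s \<mapsto> -s\<close> then replaces the exponential by the cosine.
\<close>

lemma fourier_double_cone:
  fixes h :: "real \<Rightarrow> complex" and p q :: real and P :: "real \<Rightarrow> real \<Rightarrow> bool"
  assumes P: "\<And>s t. \<bar>t\<bar> < \<bar>s\<bar> \<Longrightarrow> P s t" "\<And>s t. P s t \<Longrightarrow> \<bar>t\<bar> \<le> \<bar>s\<bar>"
    and int: "integrable (lborel \<Otimes>\<^sub>M lborel) (\<lambda>(s, t). if P s t then h \<bar>s\<bar> else 0)"
  defines "K \<equiv> \<lambda>s t. (if P s t then h \<bar>s\<bar> else 0) * exp (- \<i> * of_real (s * p + t * q))"
  shows "integrable lborel (\<lambda>s. h \<bar>s\<bar> * of_real (cos (s * p) * sin (\<bar>s\<bar> * q)))"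
    and "of_real q * integral\<^sup>L (lborel \<Otimes>\<^sub>M lborel) (\<lambda>(s, t). K s t)
       = 2 * (LINT s|lborel. h \<bar>s\<bar> * of_real (cos (s * p) * sin (\<bar>s\<bar> * q)))"
proof -
  define J where "J s = h \<bar>s\<bar> * exp (- \<i> * of_real (s * p)) * of_real (2 * sin (\<bar>s\<bar> * q))" for s
  have intK: "integrable (lborel \<Otimes>\<^sub>M lborel) (\<lambda>(s, t). K s t)"
  proof (rule Bochner_Integration.integrable_bound[OF int])
    have [measurable]: "(\<lambda>z. if P (fst z) (snd z) then h \<bar>fst z\<bar> else 0) \<in> borel_measurable (lborel \<Otimes>\<^sub>M lborel)"
      using borel_measurable_integrable[OF int] by (simp add: case_prod_beta)
    show "(\<lambda>(s, t). K s t) \<in> borel_measurable (lborel \<Otimes>\<^sub>M lborel)"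
      unfolding K_def case_prod_beta by measurable
  qed (auto simp: K_def norm_mult)
  have inner: "of_real q * (LINT t|lborel. K s t) = J s" for s
  proof -
    have "(LINT t|lborel. K s t) =
        (LINT t|lborel. h \<bar>s\<bar> * exp (- \<i> * of_real (s * p)) * (indicator {-\<bar>s\<bar>..\<bar>s\<bar>} t *\<^sub>R exp (- \<i> * of_real (t * q))))"
    proof (rule Bochner_Integration.integral_cong_AE)
      show "AE t in lborel. K s t = h \<bar>s\<bar> * exp (- \<i> * of_real (s * p)) * (indicator {-\<bar>s\<bar>..\<bar>s\<bar>} t *\<^sub>R exp (- \<i> * of_real (t * q)))"
        using AE_lborel_singleton[of "\<bar>s\<bar>"] AE_lborel_singleton[of "- \<bar>s\<bar>"]
      proof eventually_elim
        case (elim t)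
        then have "P s t \<longleftrightarrow> t \<in> {-\<bar>s\<bar>..\<bar>s\<bar>}"
          using P[of t s] P(2)[of s t] by fastforce
        then show ?case
          by (auto simp: K_def indicator_def distrib_left exp_add exp_diff exp_minus divide_inverse)
      qed
      show "K s \<in> borel_measurable lborel"
        using measurable_compose[OF _ borel_measurable_integrable[OF intK], of "\<lambda>t. (s, t)" lborel] by simp
    qed auto
    also have "of_real q * \<dots> = J s"
      unfolding J_def using integral_exp_symmetric_interval[of "\<bar>s\<bar>" q]
      by (simp only: integral_mult_right_zero) (simp add: mult.left_commute)
    finally show ?thesis by simp
  qed
  have intJ: "integrable lborel J"
    using integrable_mult_right[OF lborel_pair.integrable_fst[OF intK], of "of_real q"] by (simp only: inner)
  have "of_real q * integral\<^sup>L (lborel \<Otimes>\<^sub>M lborel) (\<lambda>(s, t). K s t) = (LINT s|lborel. J s)"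
    by (simp only: lborel_pair.integral_fst[OF intK, symmetric] inner[symmetric] integral_mult_right_zero)
  moreover have intJ': "integrable lborel (\<lambda>s. J (- s))"
    using lborel_integrable_real_affine[OF intJ, of "-1" 0] by simp
  moreover have "(LINT s|lborel. J (- s)) = (LINT s|lborel. J s)"
    using lborel_integral_real_affine[of "-1" J 0] by simp
  moreover have even: "(\<lambda>s. J s + J (- s)) = (\<lambda>s. 4 * (h \<bar>s\<bar> * of_real (cos (s * p) * sin (\<bar>s\<bar> * q))))"
  proof
    fix s
    have "exp (- \<i> * of_real (s * p)) + exp (- \<i> * of_real (- s * p)) = of_real (2 * cos (s * p))"
      by (simp add: complex_eq_iff Re_exp Im_exp)
    then have "h \<bar>s\<bar> * of_real (2 * sin (\<bar>s\<bar> * q)) * (exp (- \<i> * of_real (s * p)) + exp (- \<i> * of_real (- s * p)))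
       = h \<bar>s\<bar> * of_real (2 * sin (\<bar>s\<bar> * q)) * of_real (2 * cos (s * p))"
      by simp
    then show "J s + J (- s) = 4 * (h \<bar>s\<bar> * of_real (cos (s * p) * sin (\<bar>s\<bar> * q)))"
      by (simp add: J_def algebra_simps)
  qed
  ultimately have main: "2 * (of_real q * integral\<^sup>L (lborel \<Otimes>\<^sub>M lborel) (\<lambda>(s, t). K s t))
      = (LINT s|lborel. 4 * (h \<bar>s\<bar> * of_real (cos (s * p) * sin (\<bar>s\<bar> * q))))"
    using Bochner_Integration.integral_add[OF intJ intJ'] by simp
  have "integrable lborel (\<lambda>s. 1 / 4 * (J s + J (- s)))"
    by (intro integrable_mult_right Bochner_Integration.integrable_add intJ intJ')
  then show "integrable lborel (\<lambda>s. h \<bar>s\<bar> * of_real (cos (s * p) * sin (\<bar>s\<bar> * q)))"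
    unfolding fun_cong[OF even] by simp
  show "of_real q * integral\<^sup>L (lborel \<Otimes>\<^sub>M lborel) (\<lambda>(s, t). K s t)
       = 2 * (LINT s|lborel. h \<bar>s\<bar> * of_real (cos (s * p) * sin (\<bar>s\<bar> * q)))"
    using main by (simp only: integral_mult_right_zero) simp
qed

text \<open>
  The two cones contribute \<open>2 p cos(sp) sin(|s|q)\<close> and \<open>2 q cos(sq) sin(|s|p)\<close>, where \<open>p = y\<^sub>1\<close> and \<open>q = y\<^sub>2\<close>.
  By the addition formulas their sum depends only on \<open>p + q\<close> and \<open>p - q\<close>, and it separates into a function
  of the one minus the same function of the other.
\<close>

lemma fourier_of_max:
  fixes h :: "real \<Rightarrow> complex" and y :: "real^2"
  defines "F \<equiv> \<lambda>x::real^2. h (max \<bar>x $ 1\<bar> \<bar>x $ 2\<bar>)"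
    and "S \<equiv> \<lambda>u. of_real u * (LINT s|lborel. h \<bar>s\<bar> * of_real (sin (\<bar>s\<bar> * u)))"
  assumes F: "integrable lborel F" and h: "integrable lborel (\<lambda>s. h \<bar>s\<bar>)"
  shows "of_real (y $ 1 * y $ 2) * fourier F y = S (y $ 1 + y $ 2) - S (y $ 1 - y $ 2)"
proof -
  define p q where "p = y $ 1" and "q = y $ 2"
  let ?M = "lborel \<Otimes>\<^sub>M lborel :: (real \<times> real) measure"
  define Q where "Q s t = h (max \<bar>s\<bar> \<bar>t\<bar>)" for s t
  define e where "e s t = exp (- \<i> * of_real (s * p + t * q))" for s t
  have h_meas[measurable]: "(\<lambda>s. h \<bar>s\<bar>) \<in> borel_measurable borel"
    using h by auto
  have intQ: "integrable ?M (\<lambda>(s, t). Q s t)"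
    using integrable_max_profile[OF F[unfolded F_def] h_meas] by (simp add: Q_def)
  have [measurable]: "(\<lambda>(s, t). Q s t) \<in> borel_measurable ?M"
    using intQ by (rule borel_measurable_integrable)
  have e_meas[measurable]: "(\<lambda>(s, t). e s t) \<in> borel_measurable ?M"
    unfolding e_def case_prod_beta by measurable
  have Qe_meas: "(\<lambda>(s, t). Q s t * e s t) \<in> borel_measurable ?M"
  proof -
    have "(\<lambda>z. (case z of (s, t) \<Rightarrow> Q s t) * (case z of (s, t) \<Rightarrow> e s t)) \<in> borel_measurable ?M"
      by measurable
    then show ?thesis by (simp add: case_prod_beta)
  qed
  have "fourier F y = (LINT x::real^2|lborel. (\<lambda>(s, t). Q s t * e s t) (x $ 1, x $ 2))"
    by (simp add: fourier_def F_def Q_def e_def p_def q_def inner_vec_def sum_2 mult.commute)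
  also have "\<dots> = integral\<^sup>L ?M (\<lambda>(s, t). Q s t * e s t)"
    unfolding distr_lborel_vec2[symmetric]
    by (rule integral_distr[OF measurable_vec2, symmetric]) (use Qe_meas in \<open>simp add: distr_lborel_vec2 lborel_prod\<close>)
  finally have fF: "fourier F y = integral\<^sup>L ?M (\<lambda>(s, t). Q s t * e s t)" .

  \<comment> \<open>The two double cones; the second one is swapped, so that in both the first coordinate dominates.\<close>
  define Q1 where "Q1 s t = (if \<bar>t\<bar> \<le> \<bar>s\<bar> then h \<bar>s\<bar> else 0)" for s t
  define Q2 where "Q2 s t = (if \<bar>t\<bar> < \<bar>s\<bar> then h \<bar>s\<bar> else 0)" for s t
  have Q_split: "Q s t = Q1 s t + Q2 t s" for s t
    by (auto simp: Q_def Q1_def Q2_def max_def)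
  have Q1_meas[measurable]: "(\<lambda>(s, t). Q1 s t) \<in> borel_measurable ?M"
    unfolding Q1_def by measurable
  have Q2_meas[measurable]: "(\<lambda>(s, t). Q2 t s) \<in> borel_measurable ?M"
    unfolding Q2_def by measurable
  have int1: "integrable ?M (\<lambda>(s, t). Q1 s t)"
    by (rule Bochner_Integration.integrable_bound[OF intQ]) (auto simp: Q1_def Q_def max_def)
  have int2': "integrable ?M (\<lambda>(s, t). Q2 t s)"
    by (rule Bochner_Integration.integrable_bound[OF intQ]) (auto simp: Q2_def Q_def max_def)
  have int2: "integrable ?M (\<lambda>(s, t). Q2 s t)"
    using lborel_pair.integrable_product_swap[OF int2'] by simp
  have int1e: "integrable ?M (\<lambda>(s, t). Q1 s t * e s t)"
    by (rule Bochner_Integration.integrable_bound[OF int1]) (auto simp: e_def norm_mult case_prod_beta)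
  have int2e: "integrable ?M (\<lambda>(s, t). Q2 t s * e s t)"
    by (rule Bochner_Integration.integrable_bound[OF int2']) (auto simp: e_def norm_mult case_prod_beta)
  have sum: "fourier F y = integral\<^sup>L ?M (\<lambda>(s, t). Q1 s t * e s t) + integral\<^sup>L ?M (\<lambda>(s, t). Q2 t s * e s t)"
    unfolding fF using Bochner_Integration.integral_add[OF int1e int2e]
    by (simp add: split_def Q_split distrib_right)

  define C where "C a b s = h \<bar>s\<bar> * of_real (cos (s * a) * sin (\<bar>s\<bar> * b))" for a b s
  have C1: "integrable lborel (C p q)" "of_real q * integral\<^sup>L ?M (\<lambda>(s, t). Q1 s t * e s t) = 2 * (LINT s|lborel. C p q s)"
    using fourier_double_cone[where P="\<lambda>s t. \<bar>t\<bar> \<le> \<bar>s\<bar>" and h=h and p=p and q=q, folded Q1_def] int1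
    unfolding C_def e_def by simp_all
  have C2: "integrable lborel (C q p)" "of_real p * integral\<^sup>L ?M (\<lambda>(s, t). Q2 t s * e s t) = 2 * (LINT s|lborel. C q p s)"
  proof -
    have "integral\<^sup>L ?M (\<lambda>(s, t). Q2 t s * e s t) = integral\<^sup>L ?M (\<lambda>(s, t). Q2 s t * exp (- \<i> * of_real (s * q + t * p)))"
    proof -
      have "e t s = exp (- \<i> * of_real (s * q + t * p))" for s t
        by (simp only: e_def add.commute)
      then show ?thesis
        using lborel_pair.integral_product_swap[OF borel_measurable_integrable[OF int2e]]
        by (simp only: prod.case)
    qed
    then show "integrable lborel (C q p)" "of_real p * integral\<^sup>L ?M (\<lambda>(s, t). Q2 t s * e s t) = 2 * (LINT s|lborel. C q p s)"
      using fourier_double_cone[where P="\<lambda>s t. \<bar>t\<bar> < \<bar>s\<bar>" and h=h and p=q and q=p, folded Q2_def] int2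
      unfolding C_def by simp_all
  qed
  have sin_int: "integrable lborel (\<lambda>s. h \<bar>s\<bar> * of_real (sin (\<bar>s\<bar> * u)))" for u
    by (rule Bochner_Integration.integrable_bound[OF h]) (auto simp: norm_mult mult_left_le)
  have pointwise: "2 * (of_real p * C p q s + of_real q * C q p s)
     = of_real (p + q) * (h \<bar>s\<bar> * of_real (sin (\<bar>s\<bar> * (p + q)))) - of_real (p - q) * (h \<bar>s\<bar> * of_real (sin (\<bar>s\<bar> * (p - q))))" for s
  proof -
    have "cos (s * a) = cos (\<bar>s\<bar> * a)" for a by (simp add: abs_if)
    then have "2 * (p * (cos (s * p) * sin (\<bar>s\<bar> * q)) + q * (cos (s * q) * sin (\<bar>s\<bar> * p)))
      = (p + q) * sin (\<bar>s\<bar> * (p + q)) - (p - q) * sin (\<bar>s\<bar> * (p - q))"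
      by (simp add: distrib_left right_diff_distrib sin_add sin_diff) (simp add: algebra_simps)
    then have "h \<bar>s\<bar> * of_real (2 * (p * (cos (s * p) * sin (\<bar>s\<bar> * q)) + q * (cos (s * q) * sin (\<bar>s\<bar> * p))))
      = h \<bar>s\<bar> * of_real ((p + q) * sin (\<bar>s\<bar> * (p + q)) - (p - q) * sin (\<bar>s\<bar> * (p - q)))"
      by (simp only:)
    then show ?thesis
      unfolding C_def of_real_add of_real_mult of_real_diff of_real_numeral by (simp only: algebra_simps)
  qed
  have "of_real (p * q) * fourier F y = of_real p * (of_real q * integral\<^sup>L ?M (\<lambda>(s, t). Q1 s t * e s t))
      + of_real q * (of_real p * integral\<^sup>L ?M (\<lambda>(s, t). Q2 t s * e s t))"
    unfolding sum by (simp add: algebra_simps)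
  also have "\<dots> = (LINT s|lborel. 2 * (of_real p * C p q s + of_real q * C q p s))"
    unfolding C1(2) C2(2) using C1(1) C2(1) by (simp add: algebra_simps)
  also have "\<dots> = S (p + q) - S (p - q)"
    unfolding pointwise S_def using sin_int by simp
  finally show ?thesis unfolding p_def q_def .
qed

section \<open>Decay of the representing function\<close>

text \<open>
  By monotonicity \<open>n\<^sup>2 G(2n)\<close> is at most the integral of \<open>t G(t)\<close> over \<open>[n, 2n]\<close>, which is bounded by the
  tail of a convergent integral.
\<close>

lemma decay_of_weighted_integral:
  fixes G :: "real \<Rightarrow> ennreal"
  assumes anti: "antimono G" and fin: "(\<integral>\<^sup>+t\<in>{0..}. ennreal t * G t \<partial>lborel) < \<infinity>"
  shows "(\<lambda>n. ennreal ((real n)\<^sup>2) * G (2 * real n)) \<longlonglongrightarrow> 0"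
proof -
  have [measurable]: "G \<in> borel_measurable borel"
  proof (rule borel_measurableI_greater)
    fix c
    have "is_interval {t. c < G t}"
      unfolding is_interval_1 using antimonoD[OF anti] by (auto intro: less_le_trans)
    then show "{t \<in> space borel. c < G t} \<in> sets borel"
      by (simp add: real_interval_borel_measurable)
  qed
  define f where "f n t = ennreal t * G t * indicator {real n..} t" for n t
  have lim: "(\<lambda>n. \<integral>\<^sup>+t. f n t \<partial>lborel) \<longlonglongrightarrow> (\<integral>\<^sup>+t. 0 \<partial>(lborel::real measure))"
  proof (rule nn_integral_dominated_convergence[where w="f 0"])
    show "AE t in lborel. f n t \<le> f 0 t" for n
      by (auto simp: f_def indicator_def)
    have "\<forall>\<^sub>F n in sequentially. f n t = 0" for t
      using eventually_gt_at_top[of "nat \<lceil>t\<rceil>"]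
    proof eventually_elim
      case (elim n)
      then have "t < real n" by linarith
      then show ?case by (simp add: f_def)
    qed
    then show "AE t in lborel. (\<lambda>n. f n t) \<longlonglongrightarrow> 0"
      by (auto intro: tendsto_eventually)
  qed (use fin in \<open>auto simp: f_def[abs_def]\<close>)
  have le: "ennreal ((real n)\<^sup>2) * G (2 * real n) \<le> (\<integral>\<^sup>+t. f n t \<partial>lborel)" for n
  proof -
    have "ennreal ((real n)\<^sup>2) * G (2 * real n) = (\<integral>\<^sup>+t. ennreal (real n) * G (2 * real n) * indicator {real n..2 * real n} t \<partial>lborel)"
    proof -
      have "(\<integral>\<^sup>+t. ennreal (real n) * G (2 * real n) * indicator {real n..2 * real n} t \<partial>lborel)
          = ennreal (real n) * G (2 * real n) * ennreal (real n)"
        by (subst nn_integral_cmult_indicator) auto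
      then show ?thesis
        by (simp add: power2_eq_square ennreal_mult mult_ac)
    qed
    also have "\<dots> \<le> (\<integral>\<^sup>+t. f n t \<partial>lborel)"
      by (intro nn_integral_mono)
         (auto simp: f_def indicator_def intro!: mult_mono ennreal_leI antimonoD[OF anti])
    finally show ?thesis .
  qed
  show ?thesis
  proof (rule tendsto_sandwich[OF _ _ tendsto_const])
    show "(\<lambda>n. \<integral>\<^sup>+t. f n t \<partial>lborel) \<longlonglongrightarrow> 0"
      using lim unfolding nn_integral_const mult_zero_left .
    show "\<forall>\<^sub>F n in sequentially. ennreal ((real n)\<^sup>2) * G (2 * real n) \<le> (\<integral>\<^sup>+t. f n t \<partial>lborel)"
      using le by (intro always_eventually allI)
  qed simp
qed

text \<open>
  Replacing the Lebesgue measurable representing function by a Borel function changes neither its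
  transform nor its essential bounds, and it makes Fubini's theorem for the product of Borel measures
  applicable.
\<close>

lemma A_star_imp_fourier:
  fixes f :: "real^2 \<Rightarrow> complex"
  assumes "f \<in> A_star"
  obtains g G where "g \<in> borel_measurable borel" "f = fourier g"
    "antimono G" "(\<integral>\<^sup>+t\<in>{0..}. ennreal t * G t \<partial>lborel) < \<infinity>"
    "\<And>t. AE y in lborel. t \<le> norm y \<longrightarrow> ennreal (norm (g y)) \<le> G t"
proof -
  obtain g where g[measurable]: "g \<in> borel_measurable lebesgue" and fin: "A_star_norm g < \<infinity>"
    and f: "\<And>x. f x = (LINT y|lebesgue. g y * exp (- \<i> * complex_of_real (x \<bullet> y)))"
    using assms unfolding A_star_def by blast
  define G where "G t = esssup (restrict_space lebesgue {y::real^2. t \<le> norm y}) (\<lambda>y. ennreal (norm (g y)))" for t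
  have sets: "{y::real^2. t \<le> norm y} \<in> sets lebesgue" for t
    by (intro sets_completionI_sets) (unfold sets_lborel, intro borel_closed closed_Collect_le continuous_intros)
  have G: "AE y in lebesgue. t \<le> norm y \<longrightarrow> ennreal (norm (g y)) \<le> G t" for t
  proof -
    have "AE y in restrict_space lebesgue {y::real^2. t \<le> norm y}. ennreal (norm (g y)) \<le> G t"
      unfolding G_def by (rule esssup_AE)
    then show ?thesis
      using sets[of t] by (subst (asm) AE_restrict_space_iff) auto
  qed
  have "antimono G"
  proof (rule antimonoI)
    fix s t :: real assume st: "s \<le> t"
    have "AE y in restrict_space lebesgue {y::real^2. t \<le> norm y}. ennreal (norm (g y)) \<le> G s"
      using sets[of t] G[of s] st by (subst AE_restrict_space_iff) auto
    then show "G t \<le> G s"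
      unfolding G_def[of t] by (intro esssup_I measurable_restrict_space1) auto
  qed
  moreover have "(\<integral>\<^sup>+t\<in>{0..}. ennreal t * G t \<partial>lborel) < \<infinity>"
    using fin unfolding A_star_norm_def G_def by (simp add: nn_integral_completion)
  moreover
  obtain u v where uv[measurable]: "u \<in> borel_measurable lborel" "v \<in> borel_measurable lborel"
    and eq: "AE y in lborel. Re (g y) = u y" "AE y in lborel. Im (g y) = v y"
    using completion_ex_borel_measurable_real[of "\<lambda>y. Re (g y)" lborel]
      completion_ex_borel_measurable_real[of "\<lambda>y. Im (g y)" lborel] g by fastforce
  define k where "k y = Complex (u y) (v y)" for y
  have k_meas: "k \<in> borel_measurable borel"
    unfolding k_def Complex_eq using uv by measurable
  have gk: "AE y in lborel. g y = k y"
    using eq by eventually_elim (simp add: k_def complex_eq_iff)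
  have "f = fourier k"
  proof
    fix x :: "real^2"
    have "(\<lambda>y. exp (- \<i> * complex_of_real (x \<bullet> y))) \<in> borel_measurable borel"
      by (intro borel_measurable_continuous_onI continuous_intros)
    then have exp_meas: "(\<lambda>y. exp (- \<i> * complex_of_real (x \<bullet> y))) \<in> borel_measurable lebesgue"
      by (intro measurable_completion) simp
    have k_leb: "k \<in> borel_measurable lebesgue"
      using k_meas by (intro measurable_completion) simp
    have "f x = (LINT y|lebesgue. k y * exp (- \<i> * complex_of_real (x \<bullet> y)))"
      unfolding f
    proof (rule Bochner_Integration.integral_cong_AE)
      show "AE y in lebesgue. g y * exp (- \<i> * complex_of_real (x \<bullet> y)) = k y * exp (- \<i> * complex_of_real (x \<bullet> y))"
        using AE_completion[OF gk] by eventually_elim simp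
    qed (intro borel_measurable_times g exp_meas k_leb)+
    also have "\<dots> = fourier k x"
      unfolding fourier_def using k_meas by (intro integral_completion) simp
    finally show "f x = fourier k x" .
  qed
  moreover have "AE y in lborel. t \<le> norm y \<longrightarrow> ennreal (norm (k y)) \<le> G t" for t
    using G[of t, unfolded AE_completion_iff] gk by eventually_elim simp
  ultimately show thesis
    using that k_meas by blast
qed

section \<open>Vanishing of the profile\<close>

text \<open>
  The comparison of \<open>S(8n)\<close> with \<open>S(a)\<close> for arbitrary fixed \<open>a\<close> forces \<open>S\<close> to be constant: the identity
  for \<open>\<F> f\<close> is multiplied by a factor of order \<open>n\<^sup>2\<close>, which the decay of the representing function still
  beats.
\<close>

lemma max_profile_eq_0:
  fixes h :: "real \<Rightarrow> complex"
  defines "F \<equiv> \<lambda>x::real^2. h (max \<bar>x $ 1\<bar> \<bar>x $ 2\<bar>)"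
  assumes F: "integrable lebesgue F" and A: "F \<in> A_star"
  shows "F x = 0"
proof -
  obtain g G where g[measurable]: "g \<in> borel_measurable borel" and Fg: "F = fourier g"
    and anti: "antimono G" and fin: "(\<integral>\<^sup>+t\<in>{0..}. ennreal t * G t \<partial>lborel) < \<infinity>"
    and G: "\<And>t. AE y in lborel. t \<le> norm y \<longrightarrow> ennreal (norm (g y)) \<le> G t"
    by (rule A_star_imp_fourier[OF A]) (rule that)
  show ?thesis
  proof (cases "integrable lborel g")
    case False
    \<comment> \<open>A finite \<open>A\<^sup>*\<close> norm excludes this case, but the value \<open>0\<close> that the Bochner integral takes for
        a non-integrable function gives the claim at once.\<close>
    have "\<not> integrable lborel (\<lambda>y. g y * exp (- \<i> * of_real (x \<bullet> y)))"
    proof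
      assume "integrable lborel (\<lambda>y. g y * exp (- \<i> * of_real (x \<bullet> y)))"
      then have "integrable lborel g"
        by (rule Bochner_Integration.integrable_bound) (auto simp: norm_mult)
      with False show False ..
    qed
    then show ?thesis
      by (simp add: Fg fourier_def not_integrable_integral_eq)
  next
    case True
    note cont = continuous_fourier[OF True, folded Fg]
    have F_cont: "continuous_on UNIV F"
      using cont by (simp add: continuous_on_eq_continuous_at)
    have F_int: "integrable lborel F"
      using F borel_measurable_continuous_onI[OF F_cont] by (simp add: integrable_completion)
    have h_eq: "h \<bar>s\<bar> = F (vector [s, 0])" for s
      by (simp add: F_def vector_2)
    have axis_cont: "continuous_on UNIV (\<lambda>s. vector [s, 0] :: real^2)"
    proof -
      have eq: "(\<lambda>s. vector [s, 0] :: real^2) = (\<lambda>s. s *\<^sub>R axis 1 1)"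
        by (simp add: fun_eq_iff vec_eq_iff forall_2 vector_2 axis_def)
      show ?thesis unfolding eq by (intro continuous_intros)
    qed
    have "continuous_on UNIV (\<lambda>s. h \<bar>s\<bar>)"
      unfolding h_eq by (rule continuous_on_compose2[OF F_cont axis_cont]) simp
    then have h_meas: "(\<lambda>s. h \<bar>s\<bar>) \<in> borel_measurable borel"
      by (rule borel_measurable_continuous_onI)
    have "norm (h \<bar>s\<bar>) \<le> (LINT y|lborel. norm (g y))" for s
      unfolding h_eq Fg by (rule norm_fourier_le)
    note h_int = integrable_profile_line[OF F_int[unfolded F_def] h_meas this]
    define S where "S u = of_real u * (LINT s|lborel. h \<bar>s\<bar> * of_real (sin (\<bar>s\<bar> * u)))" for u
    have SF: "of_real (y $ 1 * y $ 2) * fourier F y = S (y $ 1 + y $ 2) - S (y $ 1 - y $ 2)" for y :: "real^2"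
      unfolding S_def F_def by (rule fourier_of_max[OF F_int[unfolded F_def] h_int])
    have decay: "(\<lambda>n. ennreal ((real n)\<^sup>2) * G (2 * real n)) \<longlonglongrightarrow> 0"
      by (rule decay_of_weighted_integral[OF anti fin])
    define m where "m n = enn2real (G (2 * real n))" for n
    have lim: "(\<lambda>n. (real n)\<^sup>2 * m n) \<longlonglongrightarrow> 0"
      using tendsto_enn2real[of "\<lambda>n. ennreal ((real n)\<^sup>2) * G (2 * real n)" 0] decay
      by (simp add: enn2real_mult m_def)
    have G_fin: "\<forall>\<^sub>F n in sequentially. G (2 * real n) < \<infinity>"
      using order_tendstoD(2)[OF decay zero_less_one] eventually_gt_at_top[of 0]
    proof eventually_elim
      case (elim n)
      then have "ennreal ((real n)\<^sup>2) * G (2 * real n) < \<infinity>"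
        using less_trans[OF _ ennreal_one_less_top] by simp
      with elim show ?case
        by (auto simp: ennreal_mult_less_top)
    qed
    have S_lim: "(\<lambda>n. S (8 * real n)) \<longlonglongrightarrow> S a" for a
    proof (rule LIM_zero_cancel, rule Lim_null_comparison)
      show "(\<lambda>n. 32 * (2 * pi)\<^sup>2 * ((real n)\<^sup>2 * m n)) \<longlonglongrightarrow> 0"
        using lim by (rule tendsto_mult_right_zero)
      show "\<forall>\<^sub>F n in sequentially. norm (S (8 * real n) - S a) \<le> 32 * (2 * pi)\<^sup>2 * ((real n)\<^sup>2 * m n)"
        using G_fin eventually_gt_at_top[of "nat \<lceil>\<bar>a\<bar>\<rceil>"]
      proof eventually_elim
        case (elim n)
        then have n: "\<bar>a\<bar> < real n" by linarith
        \<comment> \<open>The point with \<open>y\<^sub>1 + y\<^sub>2 = b\<close> and \<open>y\<^sub>1 - y\<^sub>2 = a\<close>. The factor \<open>8\<close> gives \<open>|y| \<ge> 4 n\<close>, so that the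
            ball of radius \<open>2 n\<close> around \<open>- y\<close> lies in the region \<open>|x| \<ge> 2 n\<close> controlled by \<open>m n\<close>.\<close>
        define b where "b = 8 * real n"
        have b2: "b\<^sup>2 = 64 * (real n)\<^sup>2" by (simp add: b_def power_mult_distrib)
        define y :: "real^2" where "y = vector [(b + a) / 2, (b - a) / 2]"
        have y: "y $ 1 = (b + a) / 2" "y $ 2 = (b - a) / 2"
          by (simp_all add: y_def vector_2)
        have norm_y: "4 * real n \<le> norm y"
        proof (rule power2_le_imp_le)
          have "(4 * real n)\<^sup>2 = 16 * (real n)\<^sup>2 + 0"
            by simp
          also have "\<dots> \<le> 32 * (real n)\<^sup>2 + a\<^sup>2 / 2"
            by (intro add_mono mult_right_mono) auto
          also have "\<dots> = (b\<^sup>2 + a\<^sup>2) / 2"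
            by (simp add: b2 add_divide_distrib)
          also have "\<dots> = (norm y)\<^sup>2"
            by (simp add: power2_norm_eq_inner inner_vec_def sum_2 y) (simp add: power2_eq_square field_simps)
          finally show "(4 * real n)\<^sup>2 \<le> (norm y)\<^sup>2" .
        qed simp
        have "norm (fourier F y) = norm (fourier (fourier g) (- (- y)) - (2 * pi) ^ DIM(real^2) * (0 :: complex))"
          by (simp add: Fg)
        also have "\<dots> \<le> (2 * pi) ^ DIM(real^2) * m n"
        proof (rule fourier_local_inversion[OF True F_int[unfolded Fg]])
          show "2 * real n > 0" "m n \<ge> 0" using n by (auto simp: m_def)
          show "AE x in lborel. dist x (- y) < 2 * real n \<longrightarrow> norm (g x - 0) \<le> m n"
            using G[of "2 * real n"]
          proof eventually_elim
            case (elim x)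
            show ?case
            proof
              assume "dist x (- y) < 2 * real n"
              then have "norm (x + y) < 2 * real n" by (simp add: dist_norm)
              then have "2 * real n \<le> norm x"
                using norm_y norm_triangle_ineq4[of "x + y" x] by simp
              then have "ennreal (norm (g x)) \<le> G (2 * real n)"
                using elim by simp
              then show "norm (g x - 0) \<le> m n"
                using \<open>G (2 * real n) < \<infinity>\<close> unfolding m_def
                using enn2real_mono[of "ennreal (norm (g x))" "G (2 * real n)"] by simp
            qed
          qed
        qed
        also have "(2 * pi) ^ DIM(real^2) = (2 * pi)\<^sup>2" by simp
        finally have Fy: "norm (fourier F y) \<le> (2 * pi)\<^sup>2 * m n" .
        have "\<bar>y $ 1 * y $ 2\<bar> \<le> 32 * (real n)\<^sup>2"
        proof -
          have "y $ 1 * y $ 2 = (b\<^sup>2 - a\<^sup>2) / 4" by (simp add: y power2_eq_square field_simps)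
          moreover have "a\<^sup>2 \<le> (real n)\<^sup>2" using n by (simp add: abs_le_square_iff[symmetric])
          moreover have "0 \<le> a\<^sup>2" "0 \<le> (real n)\<^sup>2" by auto
          ultimately show ?thesis
            using b2 unfolding abs_le_iff by argo
        qed
        then have "\<bar>y $ 1 * y $ 2\<bar> * norm (fourier F y) \<le> 32 * (real n)\<^sup>2 * ((2 * pi)\<^sup>2 * m n)"
          using Fy by (intro mult_mono) auto
        moreover have "S b - S a = of_real (y $ 1 * y $ 2) * fourier F y"
          unfolding SF by (simp add: y field_simps)
        ultimately show ?case
          by (simp add: b_def norm_mult abs_mult mult_ac)
      qed
    qed
    \<comment> \<open>The limit along \<open>8 n\<close> does not depend on \<open>a\<close>, and \<open>S 0 = 0\<close> because of the factor \<open>u\<close> in \<open>S\<close>.\<close>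
    have "S a = S 0" for a
      using LIMSEQ_unique[OF S_lim S_lim] .
    then have S0: "S a = 0" for a by (simp add: S_def[of 0])
    have "AE y::real^2 in lborel. y $ i \<noteq> 0" for i
      using AE_lborel_inner_neq[of "axis i 1 :: real^2" 0] by (simp add: inner_axis)
    from this[of 1] this[of 2] have zero: "AE y in lborel. fourier F y = 0"
    proof eventually_elim
      case (elim y)
      then show ?case using SF[of y] by (simp add: S0)
    qed
    have FF_meas: "fourier F \<in> borel_measurable borel"
      using continuous_fourier[OF F_int] by (intro borel_measurable_continuous_onI) (simp add: continuous_on_eq_continuous_at)
    have FF_int: "integrable lborel (fourier F)"
      using zero FF_meas by (subst integrable_cong_AE[where g="\<lambda>_. 0"]) auto
    have "fourier (fourier F) (- x) = 0"
      unfolding fourier_def[of "fourier F"]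
      using zero FF_meas by (subst integral_cong_AE[where g="\<lambda>_. 0"]) auto
    then show ?thesis
      using fourier_inversion[OF F_int FF_int cont, of x] by simp
  qed
qed

theorem mainTheorem5:
  fixes f\<^sub>0 :: "real \<Rightarrow> complex" and \<delta> :: real
  assumes "f\<^sub>0 \<in> AC_loc"
    and "integrable lebesgue (\<lambda>x::real^2. f\<^sub>0 (max \<bar>x $ 1\<bar> \<bar>x $ 2\<bar>))"
    and "(\<lambda>x::real^2. f\<^sub>0 (max \<bar>x $ 1\<bar> \<bar>x $ 2\<bar>)) \<in> A_star"
    and "\<delta> > 0"
    and "(\<integral>\<^sup>+t\<in>{0..}. ennreal (exp (\<delta> * t) *
            norm (vector_derivative f\<^sub>0 (at t within {0..}))) \<partial>lebesgue) < \<infinity>"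
  shows "\<forall>t\<ge>0. f\<^sub>0 t = 0"
proof (intro allI impI)
  fix t :: real assume "t \<ge> 0"
  then show "f\<^sub>0 t = 0"
    using max_profile_eq_0[OF assms(2,3), of "vector [t, 0]"] by (simp add: vector_2)
qed

end
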